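(* Let $\mathcal M=(E,\rho)$ be a $q$-matroid and $P(\mathcal M)$ its projectivization matroid. Then $\chi_{\mathcal M}(x)=\chi_{P(\mathcal M)}(x)$.
   Context: A $q$-matroid is a pair $(E,\rho)$ where $E$ is a finite-dimensional vector space over the finite field $\mathbb F_q$ and $\rho$ assigns to each subspace of $E$ a nonnegative integer such that $0\le\rho(V)\le\dim V$, $V\le W\Rightarrow\rho(V)\le\rho(W)$, and $\rho(V+W)+\rho(V\cap W)\le\rho(V)+\rho(W)$. $\mathbb PE$ denotes the set of $1$-dimensional subspaces of $E$; for $S\subseteq\mathbb PE$, $\langle S\rangle$ is the span of the union of the lines in $S$. The projectivization matroid is $P(\mathcal M)=(\mathbb PE,r)$ with $r(S)=\rho(\langle S\rangle)$. The characteristic polynomial of $\mathcal M$ is $\chi_{\mathcal M}(x)=\sum_{V\le E}\mu_{\mathcal L(E)}(\{0\},V)\,x^{\rho(E)-\rho(V)}$, where $\mu_{\mathcal L(E)}$ is the Möbius function of the lattice of subspaces of $E$. The characteristic polynomial of a matroid $M=(S,r)$ is $\chi_M(x)=\sum_{A\subseteq S}(-1)^{|A|}x^{r(S)-r(A)}$. *)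

theory Defs
  imports "HOL-Computational_Algebra.Polynomial" "HOL-Library.FuncSet"
begin

text \<open>The Moebius function of a finite set \<open>P\<close> partially ordered by the ambient order, defined by
  \<open>\<mu>(x, x) = 1\<close> and \<open>\<mu>(x, y) = - (\<Sum>z | x \<le> z < y. \<mu>(x, z))\<close> for \<open>x < y\<close>.
  The finiteness test only ensures that the function is total; for \<open>x, y\<close> in a finite \<open>P\<close>
  it is always satisfied.\<close>

function moebius :: "'a::order set \<Rightarrow> 'a \<Rightarrow> 'a \<Rightarrow> int" where
  "moebius P x y =
    (if x = y then 1
     else if x < y \<and> finite {z \<in> P. x \<le> z \<and> z < y}
       then - (\<Sum>z | z \<in> P \<and> x \<le> z \<and> z < y. moebius P x z)
     else 0)"
  by auto
termination
proof (relation "measure (\<lambda>(P, x, y). card {z \<in> P. x \<le> z \<and> z < y})", goal_cases)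
  case 1
  show ?case by simp
next
  case (2 P x y z)
  then have "{u \<in> P. x \<le> u \<and> u < z} \<subset> {u \<in> P. x \<le> u \<and> u < y}"
    by (auto intro: less_trans)
  with 2 show ?case by (auto intro: psubset_card_mono)
qed

declare moebius.simps [simp del]

text \<open>Rank functions of (q-)matroids take values in \<open>nat\<close>, so that nonnegativity is implicit.\<close>

locale matroid =
  fixes S :: "'a set" and r :: "'a set \<Rightarrow> nat"
  assumes finite_ground: "finite S"
    and rank_le_card: "A \<subseteq> S \<Longrightarrow> r A \<le> card A"
    and rank_mono: "A \<subseteq> B \<Longrightarrow> B \<subseteq> S \<Longrightarrow> r A \<le> r B"
    and rank_submodular: "A \<subseteq> S \<Longrightarrow> B \<subseteq> S \<Longrightarrow> r (A \<union> B) + r (A \<inter> B) \<le> r A + r B"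
begin

definition char_poly :: "int poly" where
  "char_poly = (\<Sum>A\<in>Pow S. monom ((- 1) ^ card A) (r S - r A))"

end

text \<open>The ground space \<open>E\<close> is a finite-dimensional subspace of an ambient vector space, which is
  itself not required to be finite-dimensional. The values of \<open>\<rho>\<close> on sets other than the
  subspaces of \<open>E\<close> are irrelevant.\<close>

locale q_matroid = vector_space scale
  for scale :: "'a::{field,finite} \<Rightarrow> 'b::ab_group_add \<Rightarrow> 'b" +
  fixes E :: "'b set" and \<rho> :: "'b set \<Rightarrow> nat"
  assumes ground_subspace: "subspace E"
    and ground_finite_dim: "\<exists>B. finite B \<and> span B = E"
    and q_rank_le_dim: "subspace V \<Longrightarrow> V \<subseteq> E \<Longrightarrow> \<rho> V \<le> dim V"
    and q_rank_mono: "subspace V \<Longrightarrow> subspace W \<Longrightarrow> V \<subseteq> W \<Longrightarrow> W \<subseteq> E \<Longrightarrow> \<rho> V \<le> \<rho> W"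
    and q_rank_submodular: "subspace V \<Longrightarrow> V \<subseteq> E \<Longrightarrow> subspace W \<Longrightarrow> W \<subseteq> E \<Longrightarrow>
      \<rho> {v + w |v w. v \<in> V \<and> w \<in> W} + \<rho> (V \<inter> W) \<le> \<rho> V + \<rho> W"
begin

definition subspaces :: "'b set set" where
  "subspaces = {V. subspace V \<and> V \<subseteq> E}"

definition char_poly :: "int poly" where
  "char_poly = (\<Sum>V\<in>subspaces. monom (moebius subspaces {0} V) (\<rho> E - \<rho> V))"

definition proj_points :: "'b set set" where
  "proj_points = {L. subspace L \<and> L \<subseteq> E \<and> dim L = 1}"

definition proj_rank :: "'b set set \<Rightarrow> nat" where
  "proj_rank A = \<rho> (span (\<Union>A))"

lemma finite_ground_space: "finite E"
proof -
  obtain B where B: "finite B" "span B = E"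
    using ground_finite_dim by blast
  have "E = range (\<lambda>u. \<Sum>v\<in>B. scale (u v) v)"
    using span_finite[OF B(1)] B(2) by simp
  also have "\<dots> = (\<lambda>u. \<Sum>v\<in>B. scale (u v) v) ` (B \<rightarrow>\<^sub>E UNIV)" (is "range ?f = _")
  proof -
    have "?f u = ?f (restrict u B)" for u
      by (intro sum.cong) auto
    moreover have "restrict u B \<in> B \<rightarrow>\<^sub>E UNIV" for u :: "'b \<Rightarrow> 'a"
      by simp
    ultimately show ?thesis
      by blast
  qed
  also have "finite \<dots>"
    using B(1) by (intro finite_imageI finite_PiE) auto
  finally show ?thesis .
qed

lemma span_Union_points_le:
  assumes "A \<subseteq> proj_points"
  shows "span (\<Union>A) \<subseteq> E"
  using assms ground_subspace by (intro span_minimal) (auto simp: proj_points_def)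

lemma dim_span_Union_points_le:
  assumes "A \<subseteq> proj_points" "finite A"
  shows "dim (span (\<Union>A)) \<le> card A"
proof -
  have "\<exists>v. L \<subseteq> span {v}" if "L \<in> A" for L
  proof -
    have "dim L = 1"
      using that assms(1) by (auto simp: proj_points_def)
    moreover obtain B where B: "B \<subseteq> L" "independent B" "L \<subseteq> span B" "card B = dim L"
      using basis_exists by blast
    ultimately show ?thesis
      by (metis card_1_singletonE)
  qed
  then obtain g where g: "\<And>L. L \<in> A \<Longrightarrow> L \<subseteq> span {g L}"
    by metis
  have "\<Union>A \<subseteq> span (g ` A)"
  proof
    fix x assume "x \<in> \<Union>A"
    then obtain L where "L \<in> A" "x \<in> L" by blast
    with g show "x \<in> span (g ` A)"
      using span_mono[of "{g L}" "g ` A"] by blast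
  qed
  then have "dim (\<Union>A) \<le> card (g ` A)"
    using assms(2) by (intro dim_le_card) auto
  also have "\<dots> \<le> card A"
    using assms(2) by (rule card_image_le)
  finally show ?thesis by simp
qed

text \<open>The projectivization matroid.\<close>

sublocale P: matroid proj_points proj_rank
proof
  have "proj_points \<subseteq> Pow E"
    by (auto simp: proj_points_def)
  then show fin: "finite proj_points"
    using finite_ground_space finite_subset by blast
  show "proj_rank A \<le> card A" if A: "A \<subseteq> proj_points" for A
  proof -
    have "proj_rank A \<le> dim (span (\<Union>A))"
      unfolding proj_rank_def using span_Union_points_le[OF A] by (intro q_rank_le_dim) auto
    also have "\<dots> \<le> card A"
      using A fin finite_subset by (intro dim_span_Union_points_le) auto
    finally show ?thesis .
  qed
  show "proj_rank A \<le> proj_rank B" if "A \<subseteq> B" "B \<subseteq> proj_points" for A B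
    unfolding proj_rank_def using that
    by (intro q_rank_mono span_mono span_Union_points_le) auto
  show "proj_rank (A \<union> B) + proj_rank (A \<inter> B) \<le> proj_rank A + proj_rank B"
    if A: "A \<subseteq> proj_points" and B: "B \<subseteq> proj_points" for A B
  proof -
    let ?V = "span (\<Union>A)" and ?W = "span (\<Union>B)"
    have "span (\<Union>(A \<inter> B)) \<subseteq> ?V \<inter> ?W"
      by (simp add: span_mono Union_mono)
    then have "proj_rank (A \<inter> B) \<le> \<rho> (?V \<inter> ?W)"
      unfolding proj_rank_def using span_Union_points_le[OF A]
      by (intro q_rank_mono) (auto simp: subspace_inter)
    moreover have "proj_rank (A \<union> B) = \<rho> {v + w |v w. v \<in> ?V \<and> w \<in> ?W}"
      by (simp add: proj_rank_def span_Un)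
    moreover have "\<rho> {v + w |v w. v \<in> ?V \<and> w \<in> ?W} + \<rho> (?V \<inter> ?W) \<le> \<rho> ?V + \<rho> ?W"
      using span_Union_points_le[OF A] span_Union_points_le[OF B]
      by (intro q_rank_submodular) auto
    ultimately show ?thesis
      by (simp add: proj_rank_def)
  qed
qed

end

end

theory Submission
  imports Defs
begin

text \<open>Collect the terms of the characteristic polynomial of the projectivization by the
  subspace \<open>V\<close> spanned by a set of points. The signed number \<open>g(V)\<close> of sets of points spanning
  \<open>V\<close> satisfies \<open>(\<Sum>W \<le> V. g(W)) = (\<Sum>A. (-1) ^ |A|)\<close>, where \<open>A\<close> ranges over all sets of
  points of \<open>V\<close>. This is \<open>1\<close> if \<open>V\<close> has no points, that is \<open>V = {0}\<close>, and \<open>0\<close> otherwise, which is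
  the recursion defining \<open>\<mu>({0}, V)\<close>.\<close>

text \<open>The product of \<open>(- 1) + 1\<close> over \<open>A\<close> expands into this sum and
  equals \<open>0 ^ card A\<close>.\<close>

lemma sum_Pow_neg_one_power_card:
  assumes "finite A"
  shows "(\<Sum>B\<in>Pow A. (- 1 :: 'a::comm_ring_1) ^ card B) = (if A = {} then 1 else 0)"
  using prod_add[OF assms, of "\<lambda>_. - 1 :: 'a" "\<lambda>_. 1"] assms
  by (simp add: power_0_left split: if_splits)

context q_matroid
begin

lemma finite_subspaces: "finite subspaces"
  by (rule finite_subset[of _ "Pow E"]) (auto simp: subspaces_def finite_ground_space)

lemma span_Union_in_subspaces: "A \<subseteq> proj_points \<Longrightarrow> span (\<Union>A) \<in> subspaces"
  using span_Union_points_le by (simp add: subspaces_def)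

lemma span_singleton_in_proj_points:
  assumes "v \<in> E" "v \<noteq> 0"
  shows "span {v} \<in> proj_points"
  using assms ground_subspace span_minimal[of "{v}" E] dim_span_eq_card_independent[of "{v}"]
  by (auto simp: proj_points_def)

lemma exists_point:
  assumes "V \<in> subspaces" "V \<noteq> {0}"
  shows "\<exists>L\<in>proj_points. L \<subseteq> V"
proof -
  have V: "subspace V" "V \<subseteq> E" using assms(1) by (auto simp: subspaces_def)
  then obtain v where v: "v \<in> V" "v \<noteq> 0" using assms(2) subspace_0 by blast
  then show ?thesis
    using V span_singleton_in_proj_points[of v] span_minimal[of "{v}" V]
    by (intro bexI[of _ "span {v}"]) auto
qed

text \<open>The fibres of \<open>A \<mapsto> span (\<Union>A)\<close> on sets of points. Over all
  \<open>V \<in> subspaces\<close> they partition \<open>Pow proj_points\<close>.\<close>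

definition spanning_point_sets :: "'b set \<Rightarrow> 'b set set set" where
  "spanning_point_sets V = {A. A \<subseteq> proj_points \<and> span (\<Union>A) = V}"

lemma finite_spanning_point_sets: "finite (spanning_point_sets V)"
  by (rule finite_subset[of _ "Pow proj_points"])
    (auto simp: spanning_point_sets_def P.finite_ground)

lemma sum_spanning_point_sets_below:
  assumes V: "V \<in> subspaces"
  shows "(\<Sum>W | W \<in> subspaces \<and> W \<subseteq> V. \<Sum>A\<in>spanning_point_sets W. (- 1 :: int) ^ card A) =
    (if V = {0} then 1 else 0)"
proof -
  let ?P = "{L \<in> proj_points. L \<subseteq> V}"
  have fin: "finite ?P" using P.finite_ground by simp
  \<comment> \<open>This turns the condition on the span into one on each single point, so the sets
    to be counted form a full power set.\<close>
  have below: "span (\<Union>A) \<subseteq> V \<longleftrightarrow> \<Union>A \<subseteq> V" for A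
    using V span_minimal[of "\<Union>A" V] span_superset[of "\<Union>A"] by (auto simp: subspaces_def)
  have "(\<Sum>W | W \<in> subspaces \<and> W \<subseteq> V. \<Sum>A\<in>spanning_point_sets W. (- 1 :: int) ^ card A) =
    (\<Sum>A\<in>(\<Union>W\<in>{W \<in> subspaces. W \<subseteq> V}. spanning_point_sets W). (- 1) ^ card A)"
    by (rule sum.UNION_disjoint[symmetric])
      (use finite_subspaces finite_spanning_point_sets in
        \<open>auto simp: spanning_point_sets_def\<close>)
  also have "(\<Union>W\<in>{W \<in> subspaces. W \<subseteq> V}. spanning_point_sets W) = Pow ?P"
  proof -
    have "(\<Union>W\<in>{W \<in> subspaces. W \<subseteq> V}. spanning_point_sets W) =
      {A. A \<subseteq> proj_points \<and> span (\<Union>A) \<subseteq> V}"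
      using span_Union_in_subspaces by (auto simp: spanning_point_sets_def)
    then show ?thesis unfolding below by blast
  qed
  also have "(\<Sum>A\<in>Pow ?P. (- 1 :: int) ^ card A) = (if ?P = {} then 1 else 0)"
    using fin by (rule sum_Pow_neg_one_power_card)
  also have "?P = {} \<longleftrightarrow> V = {0}"
  proof
    assume "V = {0}"
    \<comment> \<open>The empty set spans \<open>{0}\<close>, so such an \<open>L\<close> would have
      dimension 0 instead of 1.\<close>
    have False if "L \<in> proj_points" "L \<subseteq> {0}" for L
      using that dim_le_card[of L "{}"] by (auto simp: proj_points_def)
    with \<open>V = {0}\<close> show "?P = {}" by blast
  qed (use exists_point[OF V] in blast)
  finally show ?thesis .
qed

text \<open>Both sides obey the same recursion over proper subspaces. Induction on
  \<open>card V\<close> works because \<open>E\<close> is a finite set, so proper subspaces have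
  fewer elements.\<close>

lemma moebius_eq_sum_spanning_point_sets:
  assumes "V \<in> subspaces"
  shows "moebius subspaces {0} V = (\<Sum>A\<in>spanning_point_sets V. (- 1) ^ card A)"
  using assms
proof (induction "card V" arbitrary: V rule: less_induct)
  case less
  let ?g = "\<lambda>V. \<Sum>A\<in>spanning_point_sets V. (- 1 :: int) ^ card A"
  have "finite V"
    using less.prems finite_ground_space finite_subset by (auto simp: subspaces_def)
  have zero: "{0} \<subseteq> W" if "W \<in> subspaces" for W
    using that by (auto simp: subspaces_def subspace_0)
  have fin: "finite {W \<in> subspaces. W \<subset> V}" using finite_subspaces by simp
  \<comment> \<open>Splitting off the term \<open>W = V\<close> lets \<open>rec\<close> express
    \<open>?g V\<close> by the values of \<open>?g\<close> at the proper subspaces.\<close>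
  have "{W \<in> subspaces. W \<subseteq> V} = insert V {W \<in> subspaces. W \<subset> V}"
    using less.prems by auto
  then have rec: "?g V + (\<Sum>W | W \<in> subspaces \<and> W \<subset> V. ?g W) = (if V = {0} then 1 else 0)"
    using sum_spanning_point_sets_below[OF less.prems] fin by simp
  show ?case
  proof (cases "V = {0}")
    case True
    then have "{W \<in> subspaces. W \<subset> V} = {}" using zero by auto
    then have "?g V = 1" using rec True by (simp only: sum.empty) simp
    then show ?thesis using True by (simp add: moebius.simps)
  next
    case False
    have interval: "{W \<in> subspaces. {0} \<le> W \<and> W < V} = {W \<in> subspaces. W \<subset> V}"
      using zero by auto
    have "{0} < V" using zero[OF less.prems] False by auto
    \<comment> \<open>The finiteness test in \<open>moebius\<close> succeeds by \<open>fin\<close>.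
      The lower bound on \<open>W\<close> disappears because \<open>{0}\<close> is the least
      subspace.\<close>
    then have "moebius subspaces {0} V =
      - (\<Sum>W | W \<in> subspaces \<and> W \<subset> V. moebius subspaces {0} W)"
      using False fin by (subst moebius.simps) (simp only: interval, simp)
    also have "\<dots> = - (\<Sum>W | W \<in> subspaces \<and> W \<subset> V. ?g W)"
      using less.hyps psubset_card_mono[OF \<open>finite V\<close>]
      by (intro arg_cong[where f = uminus] sum.cong) auto
    finally show ?thesis using rec False by simp
  qed
qed

text \<open>Needed for \<open>proj_rank proj_points = \<rho> E\<close>, so that the exponents of the
  two polynomials agree. A nonzero vector lies on the line that it spans; the zero vector lies in
  every span, even if there are no points.\<close>

lemma span_Union_proj_points: "span (\<Union>proj_points) = E"
proof
  show "span (\<Union>proj_points) \<subseteq> E" by (rule span_Union_points_le) simp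
  show "E \<subseteq> span (\<Union>proj_points)"
  proof
    fix v assume "v \<in> E"
    then have "v \<in> \<Union>proj_points" if "v \<noteq> 0"
      using that span_singleton_in_proj_points[of v] span_base[of v "{v}"] by blast
    then show "v \<in> span (\<Union>proj_points)"
      by (cases "v = 0") (auto intro: span_zero span_base)
  qed
qed

lemma char_poly_eq_proj: "char_poly = P.char_poly"
proof -
  have "char_poly = (\<Sum>V\<in>subspaces. \<Sum>A\<in>spanning_point_sets V.
      monom ((- 1) ^ card A) (proj_rank proj_points - proj_rank A))"
    unfolding char_poly_def
  proof (intro sum.cong refl)
    fix V assume "V \<in> subspaces"
    \<comment> \<open>\<open>monom\<close> is additive in the coefficient, and the exponent is
      constant on the fibre, since \<open>proj_rank A = \<rho> V\<close> for each \<open>A\<close>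
      spanning \<open>V\<close>.\<close>
    then show "monom (moebius subspaces {0} V) (\<rho> E - \<rho> V) = (\<Sum>A\<in>spanning_point_sets V.
      monom ((- 1) ^ card A) (proj_rank proj_points - proj_rank A))"
      unfolding moebius_eq_sum_spanning_point_sets[OF \<open>V \<in> subspaces\<close>] monom_sum
      by (intro sum.cong) (auto simp: spanning_point_sets_def proj_rank_def span_Union_proj_points)
  qed
  \<comment> \<open>The fibres are disjoint because a set of points has only one span.\<close>
  also have "\<dots> = (\<Sum>A\<in>(\<Union>V\<in>subspaces. spanning_point_sets V).
      monom ((- 1) ^ card A) (proj_rank proj_points - proj_rank A))"
    by (rule sum.UNION_disjoint[symmetric])
      (use finite_subspaces finite_spanning_point_sets in \<open>auto simp: spanning_point_sets_def\<close>)
  also have "(\<Union>V\<in>subspaces. spanning_point_sets V) = Pow proj_points"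
    using span_Union_in_subspaces by (auto simp: spanning_point_sets_def)
  finally show ?thesis by (simp add: P.char_poly_def)
qed

end

theorem theorem5p9:
  fixes scale :: "'a::{field,finite} \<Rightarrow> 'b::ab_group_add \<Rightarrow> 'b"
    and E :: "'b set" and \<rho> :: "'b set \<Rightarrow> nat"
  assumes "q_matroid scale E \<rho>"
  shows "q_matroid.char_poly scale E \<rho> =
    matroid.char_poly (q_matroid.proj_points scale E) (q_matroid.proj_rank scale \<rho>)"
  using assms by (rule q_matroid.char_poly_eq_proj)

end
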